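(* Let $f:[0,\infty)\to E^1$ be a continuous fuzzy-number-valued function such that the integral $\int_0^\infty f(x)\,dx$ is Cesàro summable to a fuzzy number $L\in E^1$. Suppose there exist a negative (constant) fuzzy number $u$ and a real number $x_0\ge 0$ such that $$x f(x)\succeq u\quad\text{for all } x>x_0.$$ Then the integral $\int_0^\infty f(x)\,dx$ converges to $L$.
   Context: A fuzzy number is a function $u:\mathbb{R}\to[0,1]$ that is normal ($u(t)=1$ for some $t$), fuzzy convex ($u(ct+(1-c)t')\ge\min\{u(t),u(t')\}$ for $c\in[0,1]$), upper semicontinuous, and such that $\overline{\{t\in\mathbb{R}:u(t)>0\}}$ is compact. $E^1$ is the set of fuzzy numbers. A fuzzy number $u$ is negative iff $u(t)=0$ for all $t\ge 0$. For $\alpha\in(0,1]$ the level set is $[u]_\alpha=\{t:u(t)\ge\alpha\}$, and $[u]_0=\overline{\{t:u(t)>0\}}$; these are compact intervals written $[u]_\alpha=[u_\alpha^-,u_\alpha^+]$. Addition and multiplication by $k\in\mathbb{R}$ are defined levelwise: $[u+v]_\alpha=[u_\alpha^-+v_\alpha^-,u_\alpha^++v_\alpha^+]$ and $[ku]_\alpha=k[u]_\alpha$. The metric on $E^1$ is $D(u,v)=\sup_{\alpha\in[0,1]}\max\{|u_\alpha^--v_\alpha^-|,|u_\alpha^+-v_\alpha^+|\}$; continuity and limits of $E^1$-valued functions are with respect to $D$. The partial order is: $u\preceq v$ (equivalently $v\succeq u$) iff $u_\alpha^-\le v_\alpha^-$ and $u_\alpha^+\le v_\alpha^+$ for all $\alpha\in[0,1]$.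 Integrals of $E^1$-valued functions are fuzzy Riemann integrals: $I\in E^1$ is $\int_a^b f(x)\,dx$ if for each $\varepsilon>0$ there is $\delta>0$ such that every Riemann sum $\sum_i f(\xi_i)(x_{i+1}-x_i)$ over a partition of $[a,b]$ of norm less than $\delta$ with tags $\xi_i\in[x_i,x_{i+1}]$ is at $D$-distance less than $\varepsilon$ from $I$. (For continuous $f$ it exists and $[\int_a^b f]_\alpha=[\int_a^b f_\alpha^-,\int_a^b f_\alpha^+]$, where $[f(x)]_\alpha=[f_\alpha^-(x),f_\alpha^+(x)]$.) The integral $\int_0^\infty f(x)\,dx$ converges to $L\in E^1$ if $\lim_{t\to\infty}\int_0^t f(x)\,dx=L$. For continuous $f:[0,\infty)\to E^1$ and $s(t)=\int_0^t f(x)\,dx$, the Cesàro means are $\sigma(t)=\frac1t\int_0^t s(v)\,dv$, $t\in(0,\infty)$. The integral $\int_0^\infty f(x)\,dx$ is Cesàro summable to $L\in E^1$ if $\lim_{t\to\infty}\sigma(t)=L$. *)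

theory Defs
  imports "HOL-Analysis.Analysis"
begin

section \<open>Fuzzy numbers\<close>

definition upper_semicontinuous :: "(real \<Rightarrow> real) \<Rightarrow> bool" where
  "upper_semicontinuous u \<longleftrightarrow> (\<forall>t. \<forall>e>0. \<forall>\<^sub>F s in nhds t. u s < u t + e)"

definition is_fuzzy_number :: "(real \<Rightarrow> real) \<Rightarrow> bool" where
  "is_fuzzy_number u \<longleftrightarrow>
     (\<forall>t. u t \<in> {0..1}) \<and>
     (\<exists>t. u t = 1) \<and>
     (\<forall>t t'. \<forall>c\<in>{0..1}. u (c * t + (1 - c) * t') \<ge> min (u t) (u t')) \<and>
     upper_semicontinuous u \<and>
     compact (closure {t. u t > 0})"

lemma upper_semicontinuous_closed_superlevel:
  assumes "upper_semicontinuous u"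
  shows "closed {t. u t \<ge> a}"
proof -
  have "open {t. u t < a}"
  proof (subst open_subopen, safe)
    fix t assume t: "u t < a"
    then have "\<forall>\<^sub>F s in nhds t. u s < u t + (a - u t)"
      using assms unfolding upper_semicontinuous_def by (metis diff_gt_0_iff_gt)
    then show "\<exists>T. open T \<and> t \<in> T \<and> T \<subseteq> {t. u t < a}"
      unfolding eventually_nhds by auto
  qed
  moreover have "- {t. u t < a} = {t. u t \<ge> a}" by auto
  ultimately show ?thesis by (simp add: closed_def Compl_eq not_le)
qed

lemma is_fuzzy_number_crisp: "is_fuzzy_number (indicator {r})"
proof -
  have "upper_semicontinuous (indicator {r})"
    unfolding upper_semicontinuous_def
  proof (intro allI impI)
    fix t e :: real assume "e > 0"
    show "\<forall>\<^sub>F s in nhds t. (indicator {r} s :: real) < indicator {r} t + e"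
    proof (cases "t = r")
      case True
      then show ?thesis using \<open>e > 0\<close> by (auto simp: indicator_def)
    next
      case False
      then have "\<forall>\<^sub>F s in nhds t. s \<in> - {r}"
        by (intro eventually_nhds_in_open) auto
      then show ?thesis
        by (rule eventually_mono) (use \<open>e > 0\<close> in \<open>auto simp: indicator_def\<close>)
    qed
  qed
  moreover have "{t. (indicator {r} t :: real) > 0} = {r}" by (auto simp: indicator_def)
  moreover have "min (indicator {r} t) (indicator {r} t') \<le> (indicator {r} (c * t + (1 - c) * t') :: real)"
    for t t' c :: real
    by (cases "t = r \<and> t' = r") (auto simp: indicator_def algebra_simps)
  moreover have "\<exists>t. (indicator {r} t :: real) = 1" by (rule exI[of _ r]) simp
  ultimately show ?thesis unfolding is_fuzzy_number_def by (auto simp: indicator_def)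
qed

typedef fuzzy_number = "{u. is_fuzzy_number u}"
  morphisms membership Abs_fuzzy_number
  using is_fuzzy_number_crisp by blast

definition negative_fuzzy :: "fuzzy_number \<Rightarrow> bool" where
  "negative_fuzzy u \<longleftrightarrow> (\<forall>t\<ge>0. membership u t = 0)"

subsection \<open>Level sets\<close>

definition level :: "fuzzy_number \<Rightarrow> real \<Rightarrow> real set" where
  "level u \<alpha> = (if \<alpha> = 0 then closure {t. membership u t > 0} else {t. membership u t \<ge> \<alpha>})"

definition lo :: "fuzzy_number \<Rightarrow> real \<Rightarrow> real" where
  "lo u \<alpha> = Inf (level u \<alpha>)"

definition hi :: "fuzzy_number \<Rightarrow> real \<Rightarrow> real" where
  "hi u \<alpha> = Sup (level u \<alpha>)"

lemma is_fuzzy_number_membership: "is_fuzzy_number (membership u)"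
  using membership by simp

lemma convex_superlevel:
  assumes "is_fuzzy_number u"
  shows "convex {t. u t \<ge> a}" "convex {t. u t > a}"
proof -
  have *: "u (c * t + d * t') \<ge> min (u t) (u t')" if "c \<ge> 0" "d \<ge> 0" "c + d = 1" for c d t t'
  proof -
    have "c \<in> {0..1}" and d: "d = 1 - c" using that by auto
    then show ?thesis using assms unfolding is_fuzzy_number_def d by blast
  qed
  show "convex {t. u t \<ge> a}" "convex {t. u t > a}"
    unfolding convex_def using * by (smt (verit) mem_Collect_eq min_def real_scaleR_def)+
qed

lemma level_antimono:
  assumes "0 \<le> \<alpha>" "\<alpha> \<le> \<beta>"
  shows "level u \<beta> \<subseteq> level u \<alpha>"
proof (cases "\<alpha> = 0")
  case True
  show ?thesis
  proof (cases "\<beta> = 0")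
    case False
    then have "{t. membership u t \<ge> \<beta>} \<subseteq> {t. membership u t > 0}" using assms True by auto
    then show ?thesis using True False closure_subset unfolding level_def by fastforce
  qed (use True in auto)
next
  case False
  then show ?thesis using assms unfolding level_def by auto
qed

lemma level_nonempty_compact_convex:
  assumes "\<alpha> \<in> {0..1}"
  shows "level u \<alpha> \<noteq> {}" "compact (level u \<alpha>)" "convex (level u \<alpha>)"
proof -
  note fn = is_fuzzy_number_membership[of u]
  obtain t where "membership u t = 1" using fn unfolding is_fuzzy_number_def by blast
  then have "t \<in> level u 1" by (simp add: level_def)
  then show "level u \<alpha> \<noteq> {}" using level_antimono[of \<alpha> 1 u] assms by auto
  have c0: "compact (level u 0)" using fn unfolding is_fuzzy_number_def level_def by simp
  have "closed (level u \<alpha>)"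
    using fn upper_semicontinuous_closed_superlevel unfolding is_fuzzy_number_def level_def by auto
  then show "compact (level u \<alpha>)"
    using level_antimono[of 0 \<alpha> u] assms c0
    by (metis atLeastAtMost_iff compact_Int_closed inf.absorb_iff2 order_refl)
  show "convex (level u \<alpha>)"
    using convex_superlevel[OF fn] unfolding level_def by (auto intro: convex_closure)
qed

lemma level_eq_Icc:
  assumes "\<alpha> \<in> {0..1}"
  shows "level u \<alpha> = {lo u \<alpha>..hi u \<alpha>}" "lo u \<alpha> \<le> hi u \<alpha>"
proof -
  obtain a b where ab: "level u \<alpha> = {a..b}"
    using level_nonempty_compact_convex[OF assms] convex_connected connected_compact_interval_1
    by metis
  then have "a \<le> b" using level_nonempty_compact_convex(1)[OF assms, of u] by auto
  then show "level u \<alpha> = {lo u \<alpha>..hi u \<alpha>}" "lo u \<alpha> \<le> hi u \<alpha>"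
    unfolding lo_def hi_def ab by auto
qed

lemma lo_hi_eqI:
  assumes "level u \<alpha> = {a..b}" "a \<le> b"
  shows "lo u \<alpha> = a" "hi u \<alpha> = b"
  using assms unfolding lo_def hi_def by auto

lemma lo_hi_mono:
  assumes "0 \<le> \<alpha>" "\<alpha> \<le> \<beta>" "\<beta> \<le> 1"
  shows "lo u \<alpha> \<le> lo u \<beta>" "hi u \<beta> \<le> hi u \<alpha>"
  using level_antimono[OF assms(1,2), of u] level_eq_Icc[of \<alpha> u] level_eq_Icc[of \<beta> u] assms
  by auto

lemma fuzzy_number_eqI_level:
  assumes "\<And>\<alpha>. \<alpha> \<in> {0..1} \<Longrightarrow> level u \<alpha> = level v \<alpha>"
  shows "u = v"
proof -
  have *: "membership u t \<le> membership v t"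
    if lv: "\<And>\<alpha>. \<alpha> \<in> {0..1} \<Longrightarrow> level u \<alpha> = level v \<alpha>" for u v t
  proof (cases "membership u t = 0")
    case True
    then show ?thesis
      using is_fuzzy_number_membership[of v] unfolding is_fuzzy_number_def by simp
  next
    case False
    have "membership u t \<in> {0..1}"
      using is_fuzzy_number_membership[of u] unfolding is_fuzzy_number_def by blast
    then have "level u (membership u t) = level v (membership u t)" by (rule lv)
    then show ?thesis using False unfolding level_def by auto
  qed
  have "membership u = membership v"
    using *[of u v] *[of v u] assms by (intro ext antisym) auto
  then show ?thesis by (simp add: membership_inject)
qed

lemma fuzzy_number_eqI:
  assumes "\<And>\<alpha>. \<alpha> \<in> {0..1} \<Longrightarrow> lo u \<alpha> = lo v \<alpha>"
      and "\<And>\<alpha>. \<alpha> \<in> {0..1} \<Longrightarrow> hi u \<alpha> = hi v \<alpha>"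
  shows "u = v"
  by (rule fuzzy_number_eqI_level) (simp add: level_eq_Icc assms)

text \<open>A family of intervals with the evident closure properties is the family of level sets of a
  fuzzy number; this is what makes the levelwise operations well defined.\<close>

lemma fuzzy_number_from_levels:
  fixes K :: "real \<Rightarrow> real set"
  assumes ne: "K 1 \<noteq> {}"
    and cl: "\<And>\<alpha>. \<alpha> \<in> {0<..1} \<Longrightarrow> closed (K \<alpha>)"
    and cv: "\<And>\<alpha>. \<alpha> \<in> {0<..1} \<Longrightarrow> convex (K \<alpha>)"
    and anti: "\<And>\<alpha> \<beta>. 0 < \<alpha> \<Longrightarrow> \<alpha> \<le> \<beta> \<Longrightarrow> \<beta> \<le> 1 \<Longrightarrow> K \<beta> \<subseteq> K \<alpha>"
    and cont: "\<And>\<alpha> t. \<alpha> \<in> {0<..1} \<Longrightarrow> (\<And>\<beta>. 0 < \<beta> \<Longrightarrow> \<beta> < \<alpha> \<Longrightarrow> t \<in> K \<beta>) \<Longrightarrow> t \<in> K \<alpha>"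
    and K0: "K 0 = closure (\<Union>\<alpha>\<in>{0<..1}. K \<alpha>)" "compact (K 0)"
  shows "\<exists>!w. \<forall>\<alpha>\<in>{0..1}. level w \<alpha> = K \<alpha>"
proof (rule ex_ex1I)
  define A where "A t = insert 0 {\<alpha>. \<alpha> \<in> {0<..1} \<and> t \<in> K \<alpha>}" for t
  define w where "w t = Sup (A t)" for t
  have bdd: "bdd_above (A t)" for t unfolding A_def by (intro bdd_aboveI[of _ 1]) auto
  have ne_A: "A t \<noteq> {}" for t unfolding A_def by auto
  have w01: "w t \<in> {0..1}" for t
  proof -
    have "w t \<le> 1" unfolding w_def by (rule cSup_least[OF ne_A]) (auto simp: A_def)
    moreover have "0 \<le> w t" unfolding w_def by (rule cSup_upper[OF _ bdd]) (auto simp: A_def)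
    ultimately show ?thesis by simp
  qed
  have sup: "w t \<ge> \<alpha> \<longleftrightarrow> t \<in> K \<alpha>" if a: "\<alpha> \<in> {0<..1}" for \<alpha> t
  proof
    assume "t \<in> K \<alpha>"
    then show "w t \<ge> \<alpha>" unfolding w_def using a by (intro cSup_upper[OF _ bdd]) (auto simp: A_def)
  next
    assume wt: "w t \<ge> \<alpha>"
    show "t \<in> K \<alpha>"
    proof (rule cont[OF a])
      fix \<beta> assume b: "0 < \<beta>" "\<beta> < \<alpha>"
      then have "\<beta> < Sup (A t)" using wt unfolding w_def by simp
      then obtain \<gamma> where "\<gamma> \<in> A t" "\<beta> < \<gamma>" using less_cSup_iff[OF ne_A bdd] by blast
      then show "t \<in> K \<beta>" using b anti[of \<beta> \<gamma>] unfolding A_def by auto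
    qed
  qed
  have pos: "{t. w t > 0} = (\<Union>\<alpha>\<in>{0<..1}. K \<alpha>)"
  proof (intro equalityI subsetI)
    fix t assume "t \<in> {t. w t > 0}"
    then show "t \<in> (\<Union>\<alpha>\<in>{0<..1}. K \<alpha>)" using w01[of t] sup[of "w t" t] by force
  next
    fix t assume "t \<in> (\<Union>\<alpha>\<in>{0<..1}. K \<alpha>)"
    then obtain \<alpha> where a: "\<alpha> \<in> {0<..1}" "t \<in> K \<alpha>" by blast
    then show "t \<in> {t. w t > 0}" using sup[OF a(1), of t] by auto
  qed
  have "is_fuzzy_number w"
    unfolding is_fuzzy_number_def
  proof (intro conjI allI ballI)
    show "w t \<in> {0..1}" for t by (rule w01)
    obtain t where "t \<in> K 1" using ne by blast
    then have "w t \<ge> 1" using sup[of 1 t] by simp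
    then show "\<exists>t. w t = 1" using w01[of t] by (intro exI[of _ t]) auto
    show "compact (closure {t. w t > 0})" using pos K0 by simp
    show "min (w t) (w t') \<le> w (c * t + (1 - c) * t')" if c: "c \<in> {0..1}" for t t' c
    proof (cases "min (w t) (w t') > 0")
      case False
      then show ?thesis using w01 by (meson atLeastAtMost_iff dual_order.trans not_le)
    next
      case True
      define m where "m = min (w t) (w t')"
      have m: "m \<in> {0<..1}" using True w01[of t] unfolding m_def by auto
      have "m \<le> w t" "m \<le> w t'" unfolding m_def by auto
      then have "t \<in> K m" "t' \<in> K m" using sup[OF m] by blast+
      then have "c *\<^sub>R t + (1 - c) *\<^sub>R t' \<in> K m"
        using c by (intro convexD[OF cv[OF m]]) auto
      then show ?thesis using sup[OF m, of "c * t + (1 - c) * t'"] unfolding m_def by simp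
    qed
    show "upper_semicontinuous w"
      unfolding upper_semicontinuous_def
    proof (intro allI impI)
      fix t e :: real assume e: "e > 0"
      show "\<forall>\<^sub>F s in nhds t. w s < w t + e"
      proof (cases "w t + e > 1")
        case True
        have "w s < w t + e" for s using w01[of s] True by auto
        then show ?thesis by simp
      next
        case False
        then have a: "w t + e \<in> {0<..1}" using e w01[of t] by auto
        then have "t \<in> - K (w t + e)" using sup[OF a, of t] e by auto
        then have "\<forall>\<^sub>F s in nhds t. s \<in> - K (w t + e)"
          using cl[OF a] by (intro eventually_nhds_in_open) auto
        moreover have "w s < w t + e" if "s \<in> - K (w t + e)" for s
          using sup[OF a, of s] that by (meson ComplD not_le)
        ultimately show ?thesis by (rule eventually_mono)
      qed
    qed
  qed
  then have "membership (Abs_fuzzy_number w) = w" by (simp add: Abs_fuzzy_number_inverse)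
  then have "\<forall>\<alpha>\<in>{0..1}. level (Abs_fuzzy_number w) \<alpha> = K \<alpha>"
    unfolding level_def using pos K0 sup by auto
  then show "\<exists>w. \<forall>\<alpha>\<in>{0..1}. level w \<alpha> = K \<alpha>" ..
qed (blast intro: fuzzy_number_eqI_level)

lemma level_left_continuous:
  assumes a: "\<alpha> \<in> {0<..1}" and t: "\<And>\<beta>. 0 < \<beta> \<Longrightarrow> \<beta> < \<alpha> \<Longrightarrow> t \<in> level u \<beta>"
  shows "t \<in> level u \<alpha>"
proof -
  have "\<beta> \<le> membership u t" if "0 < \<beta>" "\<beta> < \<alpha>" for \<beta>
    using t[OF that] that unfolding level_def by auto
  then have "\<alpha> \<le> membership u t" using a dense_le_bounded[of 0 \<alpha> "membership u t"] by simp
  then show ?thesis using a unfolding level_def by auto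
qed

lemma lo_hi_left_continuous:
  assumes a: "\<alpha> \<in> {0<..1}"
  shows "r < lo u \<alpha> \<Longrightarrow> \<exists>\<beta>. 0 < \<beta> \<and> \<beta> < \<alpha> \<and> r < lo u \<beta>"
    and "hi u \<alpha> < r \<Longrightarrow> \<exists>\<beta>. 0 < \<beta> \<and> \<beta> < \<alpha> \<and> hi u \<beta> < r"
proof -
  have *: "level u \<beta> = {lo u \<beta>..hi u \<beta>}" "lo u \<alpha> \<le> hi u \<beta>" "lo u \<beta> \<le> hi u \<alpha>"
    if "0 < \<beta>" "\<beta> \<le> \<alpha>" for \<beta>
    using that a level_eq_Icc[of \<beta> u] level_eq_Icc(2)[of \<alpha> u] lo_hi_mono[of \<beta> \<alpha> u] by auto
  have la: "level u \<alpha> = {lo u \<alpha>..hi u \<alpha>}" using *(1)[of \<alpha>] a by auto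
  show "\<exists>\<beta>. 0 < \<beta> \<and> \<beta> < \<alpha> \<and> r < lo u \<beta>" if r: "r < lo u \<alpha>"
  proof (rule ccontr)
    assume "\<not> ?thesis"
    then have "r \<in> level u \<beta>" if "0 < \<beta>" "\<beta> < \<alpha>" for \<beta>
      using *[of \<beta>] that r by force
    then have "r \<in> level u \<alpha>" by (rule level_left_continuous[OF a])
    then show False using r la by simp
  qed
  show "\<exists>\<beta>. 0 < \<beta> \<and> \<beta> < \<alpha> \<and> hi u \<beta> < r" if r: "hi u \<alpha> < r"
  proof (rule ccontr)
    assume "\<not> ?thesis"
    then have "r \<in> level u \<beta>" if "0 < \<beta>" "\<beta> < \<alpha>" for \<beta>
      using *[of \<beta>] that r by force
    then have "r \<in> level u \<alpha>" by (rule level_left_continuous[OF a])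
    then show False using r la by simp
  qed
qed

lemma level_0: "level u 0 = closure (\<Union>\<alpha>\<in>{0<..1}. level u \<alpha>)"
proof -
  have "{t. membership u t > 0} = (\<Union>\<alpha>\<in>{0<..1}. level u \<alpha>)"
  proof (intro equalityI subsetI)
    fix t assume t: "t \<in> {t. membership u t > 0}"
    moreover have "membership u t \<le> 1"
      using is_fuzzy_number_membership[of u] unfolding is_fuzzy_number_def by auto
    ultimately show "t \<in> (\<Union>\<alpha>\<in>{0<..1}. level u \<alpha>)"
      by (intro UN_I[of "membership u t"]) (auto simp: level_def)
  qed (auto simp: level_def)
  then show ?thesis unfolding level_def[of u 0] by simp
qed

subsection \<open>Levelwise arithmetic\<close>

text \<open>The descriptions below are proper by \<open>level_plus\<close> and \<open>level_scaleR\<close>. Only the bare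
  \<open>scaleR\<close> syntax is instantiated: fuzzy numbers do not form a vector space.\<close>

instantiation fuzzy_number :: "{zero, plus, scaleR}"
begin

definition zero_fuzzy_number :: fuzzy_number where
  "0 = Abs_fuzzy_number (indicator {0})"

definition plus_fuzzy_number :: "fuzzy_number \<Rightarrow> fuzzy_number \<Rightarrow> fuzzy_number" where
  "u + v = (THE w. \<forall>\<alpha>\<in>{0..1}. level w \<alpha> = {lo u \<alpha> + lo v \<alpha>..hi u \<alpha> + hi v \<alpha>})"

definition scaleR_fuzzy_number :: "real \<Rightarrow> fuzzy_number \<Rightarrow> fuzzy_number" where
  "k *\<^sub>R u = (THE w. \<forall>\<alpha>\<in>{0..1}. level w \<alpha> = (\<lambda>t. k * t) ` level u \<alpha>)"

instance ..

end

lemma level_zero: "\<alpha> \<in> {0..1} \<Longrightarrow> level 0 \<alpha> = {0}"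
proof -
  assume a: "\<alpha> \<in> {0..1}"
  have "membership 0 = indicator {0}"
    unfolding zero_fuzzy_number_def by (simp add: Abs_fuzzy_number_inverse is_fuzzy_number_crisp)
  moreover have "{t. (indicator {0} t :: real) > 0} = {0::real}" by (auto simp: indicator_def)
  moreover have "\<alpha> \<noteq> 0 \<Longrightarrow> {t. (indicator {0} t :: real) \<ge> \<alpha>} = {0::real}"
    using a by (auto simp: indicator_def)
  ultimately show ?thesis unfolding level_def by simp
qed

lemma Icc_sum_eq:
  fixes a b c d :: real
  assumes "a \<le> b" "c \<le> d"
  shows "{a + c..b + d} = {x + y |x y. x \<in> {a..b} \<and> y \<in> {c..d}}"
proof (intro equalityI subsetI)
  fix t assume t: "t \<in> {a + c..b + d}"
  define x where "x = max a (t - d)"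
  have "x \<in> {a..b}" "t - x \<in> {c..d}" using t assms unfolding x_def by auto
  then show "t \<in> {x + y |x y. x \<in> {a..b} \<and> y \<in> {c..d}}"
    by (intro CollectI exI[of _ x] exI[of _ "t - x"]) auto
qed auto

lemma level_plus:
  assumes "\<alpha> \<in> {0..1}"
  shows "level (u + v) \<alpha> = {lo u \<alpha> + lo v \<alpha>..hi u \<alpha> + hi v \<alpha>}"
proof -
  define K where "K \<alpha> = {lo u \<alpha> + lo v \<alpha>..hi u \<alpha> + hi v \<alpha>}" for \<alpha>
  have Ksum: "K \<alpha> = {x + y |x y. x \<in> level u \<alpha> \<and> y \<in> level v \<alpha>}" if "\<alpha> \<in> {0..1}" for \<alpha>
    unfolding K_def using level_eq_Icc[OF that] Icc_sum_eq by simp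
  have anti: "K \<beta> \<subseteq> K \<alpha>" if "0 \<le> \<alpha>" "\<alpha> \<le> \<beta>" "\<beta> \<le> 1" for \<alpha> \<beta>
    unfolding K_def using lo_hi_mono[OF that, of u] lo_hi_mono[OF that, of v] by auto
  have "\<exists>!w. \<forall>\<alpha>\<in>{0..1}. level w \<alpha> = K \<alpha>"
  proof (rule fuzzy_number_from_levels)
    show "K 1 \<noteq> {}" unfolding K_def using level_eq_Icc(2)[of 1 u] level_eq_Icc(2)[of 1 v] by auto
    show "closed (K \<alpha>)" "convex (K \<alpha>)" for \<alpha> unfolding K_def by auto
    show "compact (K 0)" unfolding K_def by auto
    show "K \<beta> \<subseteq> K \<alpha>" if "0 < \<alpha>" "\<alpha> \<le> \<beta>" "\<beta> \<le> 1" for \<alpha> \<beta> using anti that by simp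
    show "t \<in> K \<alpha>" if a: "\<alpha> \<in> {0<..1}" and t: "\<And>\<beta>. 0 < \<beta> \<Longrightarrow> \<beta> < \<alpha> \<Longrightarrow> t \<in> K \<beta>" for \<alpha> t
    proof -
      have a01: "\<alpha> \<in> {0..1}" using a by auto
      have "lo u \<alpha> + lo v \<alpha> \<le> t"
      proof (rule ccontr)
        define d where "d = (lo u \<alpha> + lo v \<alpha> - t) / 2"
        assume "\<not> ?thesis"
        then have d: "d > 0" unfolding d_def by simp
        obtain \<beta>1 \<beta>2 where b: "0 < \<beta>1" "\<beta>1 < \<alpha>" "lo u \<alpha> - d < lo u \<beta>1"
          "0 < \<beta>2" "\<beta>2 < \<alpha>" "lo v \<alpha> - d < lo v \<beta>2"
          using lo_hi_left_continuous(1)[OF a, of "lo u \<alpha> - d" u]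
            lo_hi_left_continuous(1)[OF a, of "lo v \<alpha> - d" v] d by auto
        have "t \<in> K (max \<beta>1 \<beta>2)" using b by (intro t) auto
        moreover have "lo u \<beta>1 \<le> lo u (max \<beta>1 \<beta>2)" "lo v \<beta>2 \<le> lo v (max \<beta>1 \<beta>2)"
          using b a by (auto intro!: lo_hi_mono)
        ultimately show False using b unfolding K_def d_def by (auto simp: field_simps)
      qed
      moreover have "t \<le> hi u \<alpha> + hi v \<alpha>"
      proof (rule ccontr)
        define d where "d = (t - (hi u \<alpha> + hi v \<alpha>)) / 2"
        assume "\<not> ?thesis"
        then have d: "d > 0" unfolding d_def by simp
        obtain \<beta>1 \<beta>2 where b: "0 < \<beta>1" "\<beta>1 < \<alpha>" "hi u \<beta>1 < hi u \<alpha> + d"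
          "0 < \<beta>2" "\<beta>2 < \<alpha>" "hi v \<beta>2 < hi v \<alpha> + d"
          using lo_hi_left_continuous(2)[OF a, of u "hi u \<alpha> + d"]
            lo_hi_left_continuous(2)[OF a, of v "hi v \<alpha> + d"] d by auto
        have "t \<in> K (max \<beta>1 \<beta>2)" using b by (intro t) auto
        moreover have "hi u (max \<beta>1 \<beta>2) \<le> hi u \<beta>1" "hi v (max \<beta>1 \<beta>2) \<le> hi v \<beta>2"
          using b a by (auto intro!: lo_hi_mono)
        ultimately show False using b unfolding K_def d_def by (auto simp: field_simps)
      qed
      ultimately show ?thesis unfolding K_def by simp
    qed
    show "K 0 = closure (\<Union>\<alpha>\<in>{0<..1}. K \<alpha>)"
    proof
      have "(\<Union>\<alpha>\<in>{0<..1}. K \<alpha>) \<subseteq> K 0"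
        by (intro UN_least anti) auto
      then show "closure (\<Union>\<alpha>\<in>{0<..1}. K \<alpha>) \<subseteq> K 0"
        by (rule closure_minimal) (simp add: K_def)
      define U V where "U = (\<Union>\<alpha>\<in>{0<..1}. level u \<alpha>)" and "V = (\<Union>\<alpha>\<in>{0<..1}. level v \<alpha>)"
      have "K 0 = {x + y |x y. x \<in> closure U \<and> y \<in> closure V}"
        unfolding U_def V_def level_0[symmetric] by (rule Ksum) simp
      also have "\<dots> \<subseteq> closure {x + y |x y. x \<in> U \<and> y \<in> V}"
      proof -
        have "{x + y |x y. x \<in> S \<and> y \<in> T} = S + T" for S T :: "real set"
          unfolding set_plus_def by blast
        then show ?thesis using closure_sum[of U V] by simp
      qed
      also have "\<dots> \<subseteq> closure (\<Union>\<alpha>\<in>{0<..1}. K \<alpha>)"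
      proof (rule closure_mono, safe)
        fix x y assume "x \<in> U" "y \<in> V"
        then obtain \<alpha> \<beta> where ab: "\<alpha> \<in> {0<..1}" "x \<in> level u \<alpha>" "\<beta> \<in> {0<..1}" "y \<in> level v \<beta>"
          unfolding U_def V_def by blast
        then have "x \<in> level u (min \<alpha> \<beta>)" "y \<in> level v (min \<alpha> \<beta>)"
          using level_antimono[of "min \<alpha> \<beta>" \<alpha> u] level_antimono[of "min \<alpha> \<beta>" \<beta> v] by auto
        moreover have m: "min \<alpha> \<beta> \<in> {0..1}" using ab by auto
        ultimately have "x + y \<in> K (min \<alpha> \<beta>)" unfolding Ksum[OF m] by blast
        then show "x + y \<in> (\<Union>\<alpha>\<in>{0<..1}. K \<alpha>)" using ab by (intro UN_I[of "min \<alpha> \<beta>"]) auto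
      qed
      finally show "K 0 \<subseteq> closure (\<Union>\<alpha>\<in>{0<..1}. K \<alpha>)" .
    qed
  qed
  from theI'[OF this] show ?thesis
    using assms unfolding plus_fuzzy_number_def K_def by blast
qed

lemma level_scaleR:
  assumes "\<alpha> \<in> {0..1}"
  shows "level (k *\<^sub>R u) \<alpha> = (\<lambda>t. k * t) ` level u \<alpha>"
proof -
  define K where "K \<alpha> = (\<lambda>t. k * t) ` level u \<alpha>" for \<alpha>
  have comp: "compact (K \<alpha>)" if "\<alpha> \<in> {0..1}" for \<alpha>
    unfolding K_def using level_nonempty_compact_convex(2)[OF that]
    by (intro compact_continuous_image continuous_intros)
  have "\<exists>!w. \<forall>\<alpha>\<in>{0..1}. level w \<alpha> = K \<alpha>"
  proof (rule fuzzy_number_from_levels)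
    show "K 1 \<noteq> {}" unfolding K_def using level_nonempty_compact_convex(1)[of 1 u] by auto
    show "compact (K 0)" using comp by simp
    show "closed (K \<alpha>)" if "\<alpha> \<in> {0<..1}" for \<alpha> using comp that by (intro compact_imp_closed) auto
    show "convex (K \<alpha>)" if "\<alpha> \<in> {0<..1}" for \<alpha>
      unfolding K_def using level_nonempty_compact_convex(3)[of \<alpha> u] that
        convex_scaling[of "level u \<alpha>" k] by auto
    show "K \<beta> \<subseteq> K \<alpha>" if "0 < \<alpha>" "\<alpha> \<le> \<beta>" "\<beta> \<le> 1" for \<alpha> \<beta>
      unfolding K_def using level_antimono[of \<alpha> \<beta> u] that by (intro image_mono) auto
    show "t \<in> K \<alpha>" if a: "\<alpha> \<in> {0<..1}" and t: "\<And>\<beta>. 0 < \<beta> \<Longrightarrow> \<beta> < \<alpha> \<Longrightarrow> t \<in> K \<beta>" for \<alpha> t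
    proof (cases "k = 0")
      case True
      have "t \<in> K (\<alpha> / 2)" using a by (intro t) auto
      then have "t = 0" using True unfolding K_def by auto
      then show ?thesis
        using True level_nonempty_compact_convex(1)[of \<alpha> u] a unfolding K_def by auto
    next
      case False
      then have *: "t \<in> K \<beta> \<longleftrightarrow> t / k \<in> level u \<beta>" for \<beta>
        unfolding K_def by (force simp: image_iff)
      show ?thesis using level_left_continuous[OF a, of "t / k" u] t * by blast
    qed
    show "K 0 = closure (\<Union>\<alpha>\<in>{0<..1}. K \<alpha>)"
      unfolding K_def level_0 using closure_scaleR[of k "\<Union>\<alpha>\<in>{0<..1}. level u \<alpha>"]
      by (simp add: image_UN)
  qed
  from theI'[OF this] show ?thesis
    using assms unfolding scaleR_fuzzy_number_def K_def by blast
qed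

lemma lo_hi_zero: "\<alpha> \<in> {0..1} \<Longrightarrow> lo 0 \<alpha> = 0" "\<alpha> \<in> {0..1} \<Longrightarrow> hi 0 \<alpha> = 0"
  unfolding lo_def hi_def by (simp_all add: level_zero)

lemma lo_hi_plus:
  assumes "\<alpha> \<in> {0..1}"
  shows "lo (u + v) \<alpha> = lo u \<alpha> + lo v \<alpha>" "hi (u + v) \<alpha> = hi u \<alpha> + hi v \<alpha>"
  using lo_hi_eqI[OF level_plus[OF assms]] level_eq_Icc(2)[OF assms, of u]
    level_eq_Icc(2)[OF assms, of v] by auto

instance fuzzy_number :: comm_monoid_add
  by standard (auto intro!: fuzzy_number_eqI simp: lo_hi_plus lo_hi_zero)

subsection \<open>Order and metric\<close>

instantiation fuzzy_number :: order
begin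

definition less_eq_fuzzy_number :: "fuzzy_number \<Rightarrow> fuzzy_number \<Rightarrow> bool" where
  "u \<le> v \<longleftrightarrow> (\<forall>\<alpha>\<in>{0..1}. lo u \<alpha> \<le> lo v \<alpha> \<and> hi u \<alpha> \<le> hi v \<alpha>)"

definition less_fuzzy_number :: "fuzzy_number \<Rightarrow> fuzzy_number \<Rightarrow> bool" where
  "(u :: fuzzy_number) < v \<longleftrightarrow> u \<le> v \<and> \<not> v \<le> u"

instance
proof
  fix u v w :: fuzzy_number
  show "u < v \<longleftrightarrow> u \<le> v \<and> \<not> v \<le> u" by (rule less_fuzzy_number_def)
  show "u \<le> u" unfolding less_eq_fuzzy_number_def by simp
  show "u \<le> v \<Longrightarrow> v \<le> w \<Longrightarrow> u \<le> w" unfolding less_eq_fuzzy_number_def by force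
  show "u \<le> v \<Longrightarrow> v \<le> u \<Longrightarrow> u = v"
    unfolding less_eq_fuzzy_number_def by (intro fuzzy_number_eqI) (auto intro: antisym)
qed

end

instantiation fuzzy_number :: metric_space
begin

definition dist_fuzzy_number :: "fuzzy_number \<Rightarrow> fuzzy_number \<Rightarrow> real" where
  "dist u v = (SUP \<alpha>\<in>{0..1}. max \<bar>lo u \<alpha> - lo v \<alpha>\<bar> \<bar>hi u \<alpha> - hi v \<alpha>\<bar>)"

definition uniformity_fuzzy_number :: "(fuzzy_number \<times> fuzzy_number) filter" where
  "uniformity_fuzzy_number = (INF e\<in>{0 <..}. principal {(x, y). dist x y < e})"

definition open_fuzzy_number :: "fuzzy_number set \<Rightarrow> bool" where
  "open_fuzzy_number U \<longleftrightarrow> (\<forall>x\<in>U. \<forall>\<^sub>F (x', y) in uniformity. x' = x \<longrightarrow> y \<in> U)"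

instance
proof
  show "uniformity = (INF e\<in>{0 <..}. principal {(x, y). dist (x :: fuzzy_number) y < e})"
    by (rule uniformity_fuzzy_number_def)
  show "open U \<longleftrightarrow> (\<forall>x\<in>U. \<forall>\<^sub>F (x', y) in uniformity. x' = x \<longrightarrow> y \<in> U)"
    for U :: "fuzzy_number set" by (rule open_fuzzy_number_def)
  let ?d = "\<lambda>u v \<alpha>. max \<bar>lo u \<alpha> - lo v \<alpha>\<bar> \<bar>hi u \<alpha> - hi v \<alpha>\<bar>"
  have bdd: "bdd_above (?d u v ` {0..1})" for u v
  proof (rule bdd_aboveI2)
    fix \<alpha> :: real assume a: "\<alpha> \<in> {0..1}"
    have "lo w 0 \<le> lo w \<alpha>" "lo w \<alpha> \<le> hi w 0" "lo w 0 \<le> hi w \<alpha>" "hi w \<alpha> \<le> hi w 0" for w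
      using lo_hi_mono[of 0 \<alpha> w] level_eq_Icc(2)[OF a, of w] a by auto
    from this[of u] this[of v]
    show "?d u v \<alpha> \<le> \<bar>lo u 0\<bar> + \<bar>lo v 0\<bar> + \<bar>hi u 0\<bar> + \<bar>hi v 0\<bar>" by linarith
  qed
  have le: "?d u v \<alpha> \<le> dist u v" if "\<alpha> \<in> {0..1}" for u v \<alpha>
    unfolding dist_fuzzy_number_def by (rule cSUP_upper[OF that bdd])
  have lub: "dist u v \<le> c" if "\<And>\<alpha>. \<alpha> \<in> {0..1} \<Longrightarrow> ?d u v \<alpha> \<le> c" for u v c
    unfolding dist_fuzzy_number_def by (rule cSUP_least) (use that in auto)
  fix u v w :: fuzzy_number
  show "dist u v = 0 \<longleftrightarrow> u = v"
  proof
    assume d: "dist u v = 0"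
    show "u = v"
      by (rule fuzzy_number_eqI) (use le[of _ u v] d in fastforce)+
  qed (simp add: dist_fuzzy_number_def)
  show "dist u v \<le> dist u w + dist v w"
  proof (rule lub)
    fix \<alpha> :: real assume "\<alpha> \<in> {0..1}"
    from le[OF this, of u w] le[OF this, of v w]
    show "?d u v \<alpha> \<le> dist u w + dist v w" by linarith
  qed
qed

end

section \<open>Fuzzy Riemann integral and Cesaro summability\<close>

text \<open>The degenerate interval with \<open>a = b\<close> is partitioned by \<open>n = 0\<close>, so its integral is \<open>0\<close>.\<close>

definition interval_partition :: "nat \<Rightarrow> (nat \<Rightarrow> real) \<Rightarrow> real \<Rightarrow> real \<Rightarrow> bool" where
  "interval_partition n x a b \<longleftrightarrow> x 0 = a \<and> x n = b \<and> (\<forall>i<n. x i < x (Suc i))"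

definition has_fuzzy_integral ::
    "(real \<Rightarrow> fuzzy_number) \<Rightarrow> fuzzy_number \<Rightarrow> real \<Rightarrow> real \<Rightarrow> bool" where
  "has_fuzzy_integral f I a b \<longleftrightarrow>
     (\<forall>\<epsilon>>0. \<exists>\<delta>>0. \<forall>n x \<xi>.
        interval_partition n x a b \<and>
        (\<forall>i<n. x (Suc i) - x i < \<delta>) \<and>
        (\<forall>i<n. \<xi> i \<in> {x i..x (Suc i)}) \<longrightarrow>
        dist (\<Sum>i<n. (x (Suc i) - x i) *\<^sub>R f (\<xi> i)) I < \<epsilon>)"

text \<open>For integrands without an integral the value is unspecified; continuous integrands on
  \<open>[a,b]\<close> do have one, so both integrals in the Cesaro mean of a function continuous on
  \<open>[0,\<infinity>)\<close> are genuine.\<close>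

definition fuzzy_integral :: "real \<Rightarrow> real \<Rightarrow> (real \<Rightarrow> fuzzy_number) \<Rightarrow> fuzzy_number" where
  "fuzzy_integral a b f = (THE I. has_fuzzy_integral f I a b)"

definition fuzzy_integral_converges :: "(real \<Rightarrow> fuzzy_number) \<Rightarrow> fuzzy_number \<Rightarrow> bool" where
  "fuzzy_integral_converges f L \<longleftrightarrow> ((\<lambda>t. fuzzy_integral 0 t f) \<longlongrightarrow> L) at_top"

definition cesaro_mean :: "(real \<Rightarrow> fuzzy_number) \<Rightarrow> real \<Rightarrow> fuzzy_number" where
  "cesaro_mean f t = (1 / t) *\<^sub>R fuzzy_integral 0 t (\<lambda>v. fuzzy_integral 0 v f)"

definition cesaro_summable_to :: "(real \<Rightarrow> fuzzy_number) \<Rightarrow> fuzzy_number \<Rightarrow> bool" where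
  "cesaro_summable_to f L \<longleftrightarrow> (cesaro_mean f \<longlongrightarrow> L) at_top"

end

theory Submission
  imports Defs
begin

text \<open>Levels turn every assertion into one about the real functions \<open>lo (f x) \<alpha>\<close> and
  \<open>hi (f x) \<alpha>\<close>, uniformly in \<open>\<alpha>\<close>. With \<open>s\<close> the integral function, \<open>\<sigma>\<close> its mean and
  \<open>-c \<le> lo u 0\<close>, the one-sided bound gives \<open>s v \<ge> s t - c (q - 1)\<close> for \<open>t \<le> v \<le> q t\<close>.
  Averaging over \<open>[t, q t]\<close> bounds \<open>s t\<close> from above by \<open>\<sigma> t\<close> and \<open>\<sigma> (q t)\<close>, and averaging over
  \<open>[t / q, t]\<close> bounds it from below. The resulting error \<open>c (q - 1) + \<eta> (q + 1) / (q - 1)\<close> does not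
  depend on \<open>\<alpha>\<close>; let \<open>\<eta>\<close> tend to \<open>0\<close> first and then \<open>q\<close> to \<open>1\<close>.\<close>

section \<open>Endpoints of levels\<close>

lemma lo_hi_scaleR:
  assumes "\<alpha> \<in> {0..1}" "k \<ge> 0"
  shows "lo (k *\<^sub>R u) \<alpha> = k * lo u \<alpha>" "hi (k *\<^sub>R u) \<alpha> = k * hi u \<alpha>"
proof -
  have le: "lo u \<alpha> \<le> hi u \<alpha>" by (rule level_eq_Icc(2)[OF assms(1)])
  then have "level (k *\<^sub>R u) \<alpha> = {k * lo u \<alpha>..k * hi u \<alpha>}"
    unfolding level_scaleR[OF assms(1)] level_eq_Icc(1)[OF assms(1), of u]
    \<comment> \<open>The image rule for intervals needs a positive factor. For \<open>k = 0\<close>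
      the image is \<open>{0}\<close>, because the level is nonempty.\<close>
    using assms(2) by (cases "k = 0") (auto simp: image_mult_atLeastAtMost)
  then show "lo (k *\<^sub>R u) \<alpha> = k * lo u \<alpha>" "hi (k *\<^sub>R u) \<alpha> = k * hi u \<alpha>"
    using le assms(2) by (auto intro!: lo_hi_eqI mult_left_mono)
qed

lemma lo_hi_sum:
  assumes "\<alpha> \<in> {0..1}"
  shows "lo (\<Sum>i\<in>A. g i) \<alpha> = (\<Sum>i\<in>A. lo (g i) \<alpha>)" "hi (\<Sum>i\<in>A. g i) \<alpha> = (\<Sum>i\<in>A. hi (g i) \<alpha>)"
  by (induction A rule: infinite_finite_induct) (simp_all add: lo_hi_zero[OF assms] lo_hi_plus[OF assms])

lemma lo_hi_bounds:
  assumes "\<alpha> \<in> {0..1}"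
  shows "lo u 0 \<le> lo u \<alpha>" "lo u \<alpha> \<le> hi u \<alpha>" "hi u \<alpha> \<le> hi u 0"
  using lo_hi_mono[of 0 \<alpha> u] level_eq_Icc(2)[OF assms, of u] assms by auto

text \<open>The level at 0 is the closure of the union of the positive levels. If every positive
  level lay in the closed half-line beyond \<open>r\<close>, so would this closure, including its
  endpoint.\<close>

lemma lo_hi_right_continuous_0:
  shows "lo u 0 < r \<Longrightarrow> \<exists>\<beta>\<in>{0<..1}. lo u \<beta> < r"
    and "r < hi u 0 \<Longrightarrow> \<exists>\<beta>\<in>{0<..1}. r < hi u \<beta>"
proof -
  have *: "level u \<beta> = {lo u \<beta>..hi u \<beta>}" if "\<beta> \<in> {0<..1}" for \<beta>
    using that by (intro level_eq_Icc) auto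
  have 0: "{lo u 0..hi u 0} = closure (\<Union>\<alpha>\<in>{0<..1}. level u \<alpha>)"
    using level_0[of u] level_eq_Icc(1)[of 0 u] by simp
  have le: "lo u 0 \<le> hi u 0" by (intro level_eq_Icc) auto
  show "\<exists>\<beta>\<in>{0<..1}. lo u \<beta> < r" if r: "lo u 0 < r"
  proof (rule ccontr)
    assume "\<not> ?thesis"
    then have "(\<Union>\<alpha>\<in>{0<..1}. level u \<alpha>) \<subseteq> {r..}"
      by (intro UN_least) (force simp: * not_less)
    then have "{lo u 0..hi u 0} \<subseteq> {r..}" unfolding 0 by (rule closure_minimal) simp
    then show False using le r by auto
  qed
  show "\<exists>\<beta>\<in>{0<..1}. r < hi u \<beta>" if r: "r < hi u 0"
  proof (rule ccontr)
    assume "\<not> ?thesis"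
    then have "(\<Union>\<alpha>\<in>{0<..1}. level u \<alpha>) \<subseteq> {..r}"
      by (intro UN_least) (force simp: * not_less)
    then have "{lo u 0..hi u 0} \<subseteq> {..r}" unfolding 0 by (rule closure_minimal) simp
    then show False using le r by auto
  qed
qed

section \<open>The metric and completeness through endpoint functions\<close>

text \<open>All levels lie in the level at 0, so the supremum is over a bounded family. The bound is
  non-strict because a supremum of terms below \<open>c\<close> may equal \<open>c\<close>.\<close>

lemma dist_fuzzy_le_iff:
  "dist u v \<le> c \<longleftrightarrow> (\<forall>\<alpha>\<in>{0..1}. \<bar>lo u \<alpha> - lo v \<alpha>\<bar> \<le> c \<and> \<bar>hi u \<alpha> - hi v \<alpha>\<bar> \<le> c)"
proof -
  let ?d = "\<lambda>\<alpha>. max \<bar>lo u \<alpha> - lo v \<alpha>\<bar> \<bar>hi u \<alpha> - hi v \<alpha>\<bar>"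
  have "bdd_above (?d ` {0..1})"
  proof (rule bdd_aboveI2)
    fix \<alpha> :: real assume a: "\<alpha> \<in> {0..1}"
    show "?d \<alpha> \<le> \<bar>lo u 0\<bar> + \<bar>lo v 0\<bar> + \<bar>hi u 0\<bar> + \<bar>hi v 0\<bar>"
      using lo_hi_bounds[OF a, of u] lo_hi_bounds[OF a, of v] by linarith
  qed
  then show ?thesis unfolding dist_fuzzy_number_def by (subst cSUP_le_iff) auto
qed

lemma abs_lo_hi_diff_le_dist:
  assumes "\<alpha> \<in> {0..1}"
  shows "\<bar>lo u \<alpha> - lo v \<alpha>\<bar> \<le> dist u v" "\<bar>hi u \<alpha> - hi v \<alpha>\<bar> \<le> dist u v"
  using dist_fuzzy_le_iff[of u v "dist u v"] assms by auto

text \<open>This is the completeness of the space of fuzzy numbers, stated for endpoint functions.\<close>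

lemma fuzzy_number_from_approx:
  fixes A B :: "real \<Rightarrow> real"
  assumes approx: "\<And>e. e > 0 \<Longrightarrow> \<exists>w. \<forall>\<alpha>\<in>{0..1}. \<bar>lo w \<alpha> - A \<alpha>\<bar> \<le> e \<and> \<bar>hi w \<alpha> - B \<alpha>\<bar> \<le> e"
  shows "\<exists>w. \<forall>\<alpha>\<in>{0..1}. lo w \<alpha> = A \<alpha> \<and> hi w \<alpha> = B \<alpha>"
proof -
  have AB: "A \<alpha> \<le> B \<alpha>" if a: "\<alpha> \<in> {0..1}" for \<alpha>
  proof (rule field_le_epsilon)
    fix e :: real assume "e > 0"
    then obtain w where "\<forall>\<alpha>\<in>{0..1}. \<bar>lo w \<alpha> - A \<alpha>\<bar> \<le> e/2 \<and> \<bar>hi w \<alpha> - B \<alpha>\<bar> \<le> e/2"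
      using approx[of "e/2"] by auto
    from this[rule_format, OF a] lo_hi_bounds[OF a, of w]
    show "A \<alpha> \<le> B \<alpha> + e" by arith
  qed
  have mono: "A \<alpha> \<le> A \<beta> \<and> B \<beta> \<le> B \<alpha>" if ab: "0 \<le> \<alpha>" "\<alpha> \<le> \<beta>" "\<beta> \<le> 1" for \<alpha> \<beta>
  proof -
    have "A \<alpha> \<le> A \<beta> + e \<and> B \<beta> \<le> B \<alpha> + e" if e: "e > 0" for e
    proof -
      obtain w where w: "\<forall>\<alpha>\<in>{0..1}. \<bar>lo w \<alpha> - A \<alpha>\<bar> \<le> e/2 \<and> \<bar>hi w \<alpha> - B \<alpha>\<bar> \<le> e/2"
        using approx[of "e/2"] e by auto
      have "\<alpha> \<in> {0..1}" "\<beta> \<in> {0..1}" using ab by auto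
      with w lo_hi_mono[OF ab, of w] show ?thesis by (smt (verit) field_sum_of_halves)
    qed
    then show ?thesis using field_le_epsilon by blast
  qed
  define K where "K \<alpha> = {A \<alpha>..B \<alpha>}" for \<alpha>
  have "\<exists>!w. \<forall>\<alpha>\<in>{0..1}. level w \<alpha> = K \<alpha>"
  proof (rule fuzzy_number_from_levels)
    show "K 1 \<noteq> {}" unfolding K_def using AB[of 1] by auto
    show "closed (K \<alpha>)" "convex (K \<alpha>)" for \<alpha> unfolding K_def by auto
    show "compact (K 0)" unfolding K_def by auto
    show sub: "K \<beta> \<subseteq> K \<alpha>" if "0 < \<alpha>" "\<alpha> \<le> \<beta>" "\<beta> \<le> 1" for \<alpha> \<beta>
      unfolding K_def using mono[of \<alpha> \<beta>] that by auto
    show "t \<in> K \<alpha>" if a: "\<alpha> \<in> {0<..1}" and t: "\<And>\<beta>. 0 < \<beta> \<Longrightarrow> \<beta> < \<alpha> \<Longrightarrow> t \<in> K \<beta>" for \<alpha> t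
    proof (rule ccontr)
      assume "t \<notin> K \<alpha>"
      then consider "t < A \<alpha>" | "B \<alpha> < t" unfolding K_def by fastforce
      then show False
      proof cases
        case 1
        \<comment> \<open>One third of the gap pays for the approximation at
          \<open>\<alpha>\<close>, one for the approximation at \<open>\<beta>\<close>, and one
          leaves room for left continuity of \<open>lo w\<close>. The outcome
          \<open>A \<beta> > t\<close> contradicts \<open>t \<in> K \<beta>\<close>.\<close>
        define e where "e = (A \<alpha> - t) / 3"
        have e: "e > 0" using 1 unfolding e_def by simp
        then obtain w where w: "\<forall>\<alpha>\<in>{0..1}. \<bar>lo w \<alpha> - A \<alpha>\<bar> \<le> e \<and> \<bar>hi w \<alpha> - B \<alpha>\<bar> \<le> e"
          using approx by blast
        have "\<bar>lo w \<alpha> - A \<alpha>\<bar> \<le> e" using w a by auto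
        moreover have "A \<alpha> = t + 3 * e" unfolding e_def by (simp add: field_simps)
        ultimately have "t + e < lo w \<alpha>" using e by linarith
        then obtain \<beta> where b: "0 < \<beta>" "\<beta> < \<alpha>" "t + e < lo w \<beta>"
          using lo_hi_left_continuous(1)[OF a] by blast
        have "\<bar>lo w \<beta> - A \<beta>\<bar> \<le> e" using w b a by auto
        then show False using b t[OF b(1,2)] unfolding K_def by auto
      next
        case 2
        define e where "e = (t - B \<alpha>) / 3"
        have e: "e > 0" using 2 unfolding e_def by simp
        then obtain w where w: "\<forall>\<alpha>\<in>{0..1}. \<bar>lo w \<alpha> - A \<alpha>\<bar> \<le> e \<and> \<bar>hi w \<alpha> - B \<alpha>\<bar> \<le> e"
          using approx by blast
        have "\<bar>hi w \<alpha> - B \<alpha>\<bar> \<le> e" using w a by auto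
        moreover have "B \<alpha> = t - 3 * e" unfolding e_def by (simp add: field_simps)
        ultimately have "hi w \<alpha> < t - e" using e by linarith
        then obtain \<beta> where b: "0 < \<beta>" "\<beta> < \<alpha>" "hi w \<beta> < t - e"
          using lo_hi_left_continuous(2)[OF a] by blast
        have "\<bar>hi w \<beta> - B \<beta>\<bar> \<le> e" using w b a by auto
        then show False using b t[OF b(1,2)] unfolding K_def by auto
      qed
    qed
    show "K 0 = closure (\<Union>\<alpha>\<in>{0<..1}. K \<alpha>)"
    proof
      have "K \<alpha> \<subseteq> K 0" if "\<alpha> \<in> {0<..1}" for \<alpha>
        using mono[of 0 \<alpha>] that unfolding K_def by auto
      then have "(\<Union>\<alpha>\<in>{0<..1}. K \<alpha>) \<subseteq> K 0" by (rule UN_least)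
      then show "closure (\<Union>\<alpha>\<in>{0<..1}. K \<alpha>) \<subseteq> K 0"
        by (rule closure_minimal) (simp add: K_def)
      show "K 0 \<subseteq> closure (\<Union>\<alpha>\<in>{0<..1}. K \<alpha>)"
      proof
        fix t assume t: "t \<in> K 0"
        show "t \<in> closure (\<Union>\<alpha>\<in>{0<..1}. K \<alpha>)"
          unfolding closure_approachable
        proof (intro allI impI)
          fix e :: real assume e: "e > 0"
          \<comment> \<open>Three quarters of \<open>e\<close> get spent: approximation at level 0,
            approximation at \<open>\<beta>\<close>, and right continuity of the endpoints of
            \<open>w\<close> at 0.\<close>
          then obtain w where w: "\<forall>\<alpha>\<in>{0..1}. \<bar>lo w \<alpha> - A \<alpha>\<bar> \<le> e/4 \<and> \<bar>hi w \<alpha> - B \<alpha>\<bar> \<le> e/4"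
            using approx[of "e/4"] by auto
          obtain \<beta>1 where b1: "\<beta>1 \<in> {0<..1}" "lo w \<beta>1 < lo w 0 + e/4"
            using lo_hi_right_continuous_0(1)[of w "lo w 0 + e/4"] e by auto
          obtain \<beta>2 where b2: "\<beta>2 \<in> {0<..1}" "hi w 0 - e/4 < hi w \<beta>2"
            using lo_hi_right_continuous_0(2)[of "hi w 0 - e/4" w] e by auto
          \<comment> \<open>Levels grow as \<open>\<beta>\<close> decreases, so the smaller value
            serves both endpoints.\<close>
          define \<beta> where "\<beta> = min \<beta>1 \<beta>2"
          have b: "\<beta> \<in> {0<..1}" "\<beta> \<in> {0..1}" using b1 b2 unfolding \<beta>_def by auto
          have "lo w \<beta> < lo w 0 + e/4" "hi w 0 - e/4 < hi w \<beta>"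
            using b1 b2 lo_hi_mono[of \<beta> \<beta>1 w] lo_hi_mono[of \<beta> \<beta>2 w] b unfolding \<beta>_def by auto
          moreover have "\<bar>lo w \<beta> - A \<beta>\<bar> \<le> e/4" "\<bar>hi w \<beta> - B \<beta>\<bar> \<le> e/4" using w b by auto
          moreover have "\<bar>lo w 0 - A 0\<bar> \<le> e/4" "\<bar>hi w 0 - B 0\<bar> \<le> e/4" using w by auto
          ultimately have AB': "A \<beta> < A 0 + e" "B 0 - e < B \<beta>" by linarith+
          \<comment> \<open>The projection of \<open>t\<close> onto \<open>K \<beta>\<close>; it
            moves \<open>t\<close> by less than \<open>e\<close>, since the endpoints of
            \<open>K \<beta>\<close> and \<open>K 0\<close> differ by less than that.\<close>
          define y where "y = max (A \<beta>) (min t (B \<beta>))"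
          have "y \<in> K \<beta>" unfolding K_def y_def using AB[OF b(2)] by auto
          moreover have "dist y t < e"
            using t e AB' AB[OF b(2)] unfolding K_def y_def dist_real_def by auto
          ultimately show "\<exists>y\<in>\<Union>\<alpha>\<in>{0<..1}. K \<alpha>. dist y t < e" using b by blast
        qed
      qed
    qed
  qed
  then obtain w where "\<forall>\<alpha>\<in>{0..1}. level w \<alpha> = K \<alpha>" by blast
  then have "\<forall>\<alpha>\<in>{0..1}. lo w \<alpha> = A \<alpha> \<and> hi w \<alpha> = B \<alpha>"
    using AB lo_hi_eqI unfolding K_def by metis
  then show ?thesis ..
qed

text \<open>At a fixed level each endpoint is a 1-Lipschitz function of the fuzzy number.\<close>

lemma continuous_on_lo_hi:
  assumes "continuous_on S f" "\<alpha> \<in> {0..1}"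
  shows "continuous_on S (\<lambda>x. lo (f x) \<alpha>)" "continuous_on S (\<lambda>x. hi (f x) \<alpha>)"
proof -
  have "1-lipschitz_on UNIV (\<lambda>u. lo u \<alpha>)" "1-lipschitz_on UNIV (\<lambda>u. hi u \<alpha>)"
    using abs_lo_hi_diff_le_dist[OF assms(2)] by (auto intro!: lipschitz_onI simp: dist_real_def)
  then show "continuous_on S (\<lambda>x. lo (f x) \<alpha>)" "continuous_on S (\<lambda>x. hi (f x) \<alpha>)"
    using assms(1) by (auto intro: continuous_on_compose2[OF lipschitz_on_continuous_on])
qed

section \<open>Fuzzy integrals of continuous functions\<close>

lemma fine_interval_partition_exists:
  assumes "a \<le> b" "\<delta> > 0"
  shows "\<exists>n x. interval_partition n x a b \<and> (\<forall>i<n. x (Suc i) - x i < \<delta>)"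
proof (cases "a = b")
  case True
  \<comment> \<open>Partition points increase strictly, so only \<open>n = 0\<close> fits a
    degenerate interval.\<close>
  then have "interval_partition 0 (\<lambda>_. a) a b" unfolding interval_partition_def by simp
  then show ?thesis by (intro exI[of _ 0]) auto
next
  case False
  then have ab: "b - a > 0" using assms by simp
  obtain n where n: "(b - a) / \<delta> < real n" using reals_Archimedean2 by blast
  have n0: "real n > 0" using n ab assms(2) by (smt (verit) divide_pos_pos)
  define x where "x i = a + real i * ((b - a) / n)" for i
  have step: "x (Suc i) - x i = (b - a) / n" for i
    unfolding x_def of_nat_Suc by (simp only: distrib_right)
  have "(b - a) / n < \<delta>" using n n0 assms(2) by (simp add: field_simps)
  moreover have "(b - a) / n > 0" using n0 ab by simp
  then have "x i < x (Suc i)" for i using step[of i] by linarith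
  moreover have "x 0 = a" "x n = b" using n0 unfolding x_def by auto
  ultimately show ?thesis using step unfolding interval_partition_def by metis
qed

text \<open>On each piece the error is the integral of \<open>g (\<xi> i) - g y\<close>, hence at
  most \<open>e\<close> times the length; additivity of the integral sums these bounds.\<close>

lemma riemann_sum_error:
  fixes g :: "real \<Rightarrow> real"
  assumes "\<And>i. i < n \<Longrightarrow> x i \<le> x (Suc i)"
    and "continuous_on {x 0..x n} g"
    and "\<And>i y. i < n \<Longrightarrow> y \<in> {x i..x (Suc i)} \<Longrightarrow> \<bar>g (\<xi> i) - g y\<bar> \<le> e"
  shows "\<bar>(\<Sum>i<n. (x (Suc i) - x i) * g (\<xi> i)) - integral {x 0..x n} g\<bar> \<le> e * (x n - x 0)"
  using assms
proof (induction n)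
  case 0
  then show ?case by simp
next
  case (Suc n)
  \<comment> \<open>Freezing the points beyond \<open>n\<close> through \<open>min i n\<close> gives
    a sequence that is monotone at every index, as the lifting rule demands.\<close>
  have le: "x 0 \<le> x n" using Suc.prems(1) by (intro lift_Suc_mono_le[of "\<lambda>i. x (min i n)" 0 n, simplified])
      (auto simp: min_def not_le less_eq_Suc_le)
  have leS: "x n \<le> x (Suc n)" using Suc.prems(1) by simp
  have int: "g integrable_on {x 0..x (Suc n)}"
    using Suc.prems(2) by (rule integrable_continuous_real)
  have intn: "g integrable_on {x n..x (Suc n)}"
    by (rule integrable_subinterval_real[OF int]) (use le in auto)
  have "\<bar>(\<Sum>i<n. (x (Suc i) - x i) * g (\<xi> i)) - integral {x 0..x n} g\<bar> \<le> e * (x n - x 0)"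
    using Suc.prems(1,3) leS
    by (intro Suc.IH continuous_on_subset[OF Suc.prems(2)]) auto
  moreover have "integral {x 0..x (Suc n)} g = integral {x 0..x n} g + integral {x n..x (Suc n)} g"
    using Henstock_Kurzweil_Integration.integral_combine[OF le leS int] by simp
  moreover have "\<bar>(x (Suc n) - x n) * g (\<xi> n) - integral {x n..x (Suc n)} g\<bar> \<le> e * (x (Suc n) - x n)"
  proof -
    have "(x (Suc n) - x n) * g (\<xi> n) - integral {x n..x (Suc n)} g
        = integral {x n..x (Suc n)} (\<lambda>y. g (\<xi> n) - g y)"
      using intn leS by (subst Henstock_Kurzweil_Integration.integral_diff) (auto simp: mult.commute)
    moreover have "norm \<dots> \<le> e * (x (Suc n) - x n)"
      using leS Suc.prems(3) le
      by (intro integral_bound continuous_intros continuous_on_subset[OF Suc.prems(2)]) auto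
    ultimately show ?thesis by simp
  qed
  ultimately show ?case by (simp add: algebra_simps)
qed

text \<open>The point is that one \<open>\<delta>\<close> serves all levels: uniform continuity of
  \<open>f\<close> in the supremum metric bounds the oscillation of every endpoint function at
  once.\<close>

lemma riemann_sum_error_lo_hi:
  fixes f :: "real \<Rightarrow> fuzzy_number"
  assumes f: "continuous_on {a..b} f" and "e > 0"
  shows "\<exists>\<delta>>0. \<forall>n x \<xi>. interval_partition n x a b \<and> (\<forall>i<n. x (Suc i) - x i < \<delta>) \<and>
          (\<forall>i<n. \<xi> i \<in> {x i..x (Suc i)}) \<longrightarrow>
          (\<forall>\<alpha>\<in>{0..1}.
            \<bar>lo (\<Sum>i<n. (x (Suc i) - x i) *\<^sub>R f (\<xi> i)) \<alpha> - integral {a..b} (\<lambda>x. lo (f x) \<alpha>)\<bar> \<le> e \<and>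
            \<bar>hi (\<Sum>i<n. (x (Suc i) - x i) *\<^sub>R f (\<xi> i)) \<alpha> - integral {a..b} (\<lambda>x. hi (f x) \<alpha>)\<bar> \<le> e)"
proof -
  \<comment> \<open>Chosen so that \<open>e' * (b - a) \<le> e\<close>; the absolute value and
    \<open>+ 1\<close> keep the divisor positive for any \<open>a\<close> and
    \<open>b\<close>.\<close>
  define e' where "e' = e / (\<bar>b - a\<bar> + 1)"
  have e': "e' > 0" unfolding e'_def using assms(2) by simp
  have "uniformly_continuous_on {a..b} f" using f by (intro compact_uniformly_continuous) auto
  then obtain \<delta> where d: "\<delta> > 0" and
    dd: "\<And>s t. s \<in> {a..b} \<Longrightarrow> t \<in> {a..b} \<Longrightarrow> dist s t < \<delta> \<Longrightarrow> dist (f s) (f t) < e'"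
    unfolding uniformly_continuous_on_def using e' by metis
  have "\<bar>lo (\<Sum>i<n. (x (Suc i) - x i) *\<^sub>R f (\<xi> i)) \<alpha> - integral {a..b} (\<lambda>x. lo (f x) \<alpha>)\<bar> \<le> e \<and>
        \<bar>hi (\<Sum>i<n. (x (Suc i) - x i) *\<^sub>R f (\<xi> i)) \<alpha> - integral {a..b} (\<lambda>x. hi (f x) \<alpha>)\<bar> \<le> e"
    if p: "interval_partition n x a b" "\<forall>i<n. x (Suc i) - x i < \<delta>"
      "\<forall>i<n. \<xi> i \<in> {x i..x (Suc i)}" and a: "\<alpha> \<in> {0..1}" for n x \<xi> \<alpha>
  proof -
    have x: "x 0 = a" "x n = b" "\<And>i. i < n \<Longrightarrow> x i < x (Suc i)"
      using p unfolding interval_partition_def by auto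
    have mono: "x i \<le> x j" if "i \<le> j" "j \<le> n" for i j
      using that
    proof (induction j rule: dec_induct)
      case (step j)
      then show ?case using x(3)[of j] by simp
    qed simp
    have ab: "a \<le> b" using mono[of 0 n] x by simp
    have close: "dist (f (\<xi> i)) (f y) \<le> e'" if i: "i < n" and y: "y \<in> {x i..x (Suc i)}" for i y
    proof -
      have "a \<le> x i" "x (Suc i) \<le> b" using mono[of 0 i] mono[of "Suc i" n] x i by auto
      moreover have "\<xi> i \<in> {x i..x (Suc i)}" "x (Suc i) - x i < \<delta>" using p i by auto
      ultimately show ?thesis using y by (intro less_imp_le[OF dd]) (auto simp: dist_real_def)
    qed
    have "e' * (b - a) \<le> e" unfolding e'_def using ab assms(2) by (simp add: field_simps)
    moreover have "\<bar>(\<Sum>i<n. (x (Suc i) - x i) * lo (f (\<xi> i)) \<alpha>)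
        - integral {x 0..x n} (\<lambda>x. lo (f x) \<alpha>)\<bar> \<le> e' * (x n - x 0)"
      using x order_trans[OF abs_lo_hi_diff_le_dist(1)[OF a] close] continuous_on_lo_hi(1)[OF f a]
      by (intro riemann_sum_error) (auto intro: less_imp_le)
    moreover have "\<bar>(\<Sum>i<n. (x (Suc i) - x i) * hi (f (\<xi> i)) \<alpha>)
        - integral {x 0..x n} (\<lambda>x. hi (f x) \<alpha>)\<bar> \<le> e' * (x n - x 0)"
      using x order_trans[OF abs_lo_hi_diff_le_dist(2)[OF a] close] continuous_on_lo_hi(2)[OF f a]
      by (intro riemann_sum_error) (auto intro: less_imp_le)
    moreover have "lo (\<Sum>i<n. (x (Suc i) - x i) *\<^sub>R f (\<xi> i)) \<alpha> = (\<Sum>i<n. (x (Suc i) - x i) * lo (f (\<xi> i)) \<alpha>)"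
      "hi (\<Sum>i<n. (x (Suc i) - x i) *\<^sub>R f (\<xi> i)) \<alpha> = (\<Sum>i<n. (x (Suc i) - x i) * hi (f (\<xi> i)) \<alpha>)"
      unfolding lo_hi_sum[OF a] using x(3) a
      by (auto intro!: sum.cong lo_hi_scaleR intro: less_imp_le)
    ultimately show ?thesis unfolding x(1,2) by linarith
  qed
  then show ?thesis using d by blast
qed

section \<open>Uniqueness, endpoints and continuity of the fuzzy integral\<close>

text \<open>A sufficiently fine Riemann sum would lie within half of \<open>dist I J\<close> of both
  values. For \<open>b < a\<close> there are no partitions and every fuzzy number is vacuously an
  integral, whence \<open>a \<le> b\<close>.\<close>

lemma has_fuzzy_integral_unique:
  assumes "has_fuzzy_integral f I a b" "has_fuzzy_integral f J a b" "a \<le> b"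
  shows "I = J"
proof (rule ccontr)
  assume "I \<noteq> J"
  then have e: "dist I J / 2 > 0" by simp
  obtain d1 where d1: "d1 > 0" and s1: "\<forall>n x \<xi>.
      interval_partition n x a b \<and> (\<forall>i<n. x (Suc i) - x i < d1) \<and>
      (\<forall>i<n. \<xi> i \<in> {x i..x (Suc i)}) \<longrightarrow>
      dist (\<Sum>i<n. (x (Suc i) - x i) *\<^sub>R f (\<xi> i)) I < dist I J / 2"
    using assms(1)[unfolded has_fuzzy_integral_def, rule_format, OF e] by blast
  obtain d2 where d2: "d2 > 0" and s2: "\<forall>n x \<xi>.
      interval_partition n x a b \<and> (\<forall>i<n. x (Suc i) - x i < d2) \<and>
      (\<forall>i<n. \<xi> i \<in> {x i..x (Suc i)}) \<longrightarrow>
      dist (\<Sum>i<n. (x (Suc i) - x i) *\<^sub>R f (\<xi> i)) J < dist I J / 2"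
    using assms(2)[unfolded has_fuzzy_integral_def, rule_format, OF e] by blast
  obtain n x where x: "interval_partition n x a b" "\<forall>i<n. x (Suc i) - x i < min d1 d2"
    using fine_interval_partition_exists[OF assms(3), of "min d1 d2"] d1 d2 by auto
  have tags: "\<forall>i<n. x i \<in> {x i..x (Suc i)}" using x(1) unfolding interval_partition_def by force
  have "dist (\<Sum>i<n. (x (Suc i) - x i) *\<^sub>R f (x i)) I < dist I J / 2"
    "dist (\<Sum>i<n. (x (Suc i) - x i) *\<^sub>R f (x i)) J < dist I J / 2"
    using s1[rule_format, of n x x] s2[rule_format, of n x x] x(1) tags x(2) by simp_all
  then show False using dist_triangle_half_r less_irrefl by blast
qed

text \<open>Riemann sums are fuzzy numbers whose endpoints approach the real integrals uniformly in
  the level, so completeness yields a fuzzy number \<open>I\<close> with those endpoints. The same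
  estimate shows that \<open>I\<close> is an integral, and uniqueness identifies it.\<close>

lemma lo_hi_fuzzy_integral:
  fixes f :: "real \<Rightarrow> fuzzy_number"
  assumes f: "continuous_on {a..b} f" and ab: "a \<le> b" and \<alpha>: "\<alpha> \<in> {0..1}"
  shows "lo (fuzzy_integral a b f) \<alpha> = integral {a..b} (\<lambda>x. lo (f x) \<alpha>)"
    and "hi (fuzzy_integral a b f) \<alpha> = integral {a..b} (\<lambda>x. hi (f x) \<alpha>)"
proof -
  let ?A = "\<lambda>\<alpha>. integral {a..b} (\<lambda>x. lo (f x) \<alpha>)"
  let ?B = "\<lambda>\<alpha>. integral {a..b} (\<lambda>x. hi (f x) \<alpha>)"
  have "\<exists>w. \<forall>\<alpha>\<in>{0..1}. \<bar>lo w \<alpha> - ?A \<alpha>\<bar> \<le> e \<and> \<bar>hi w \<alpha> - ?B \<alpha>\<bar> \<le> e" if e: "e > 0" for e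
  proof -
    obtain \<delta> where d: "\<delta> > 0" and s: "\<forall>n x \<xi>. interval_partition n x a b \<and> (\<forall>i<n. x (Suc i) - x i < \<delta>) \<and>
          (\<forall>i<n. \<xi> i \<in> {x i..x (Suc i)}) \<longrightarrow>
          (\<forall>\<alpha>\<in>{0..1}. \<bar>lo (\<Sum>i<n. (x (Suc i) - x i) *\<^sub>R f (\<xi> i)) \<alpha> - ?A \<alpha>\<bar> \<le> e \<and>
            \<bar>hi (\<Sum>i<n. (x (Suc i) - x i) *\<^sub>R f (\<xi> i)) \<alpha> - ?B \<alpha>\<bar> \<le> e)"
      using riemann_sum_error_lo_hi[OF f e] by blast
    obtain n x where x: "interval_partition n x a b" "\<forall>i<n. x (Suc i) - x i < \<delta>"
      using fine_interval_partition_exists[OF ab d] by blast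
    \<comment> \<open>Left endpoints serve as tags.\<close>
    have "\<forall>i<n. x i \<in> {x i..x (Suc i)}" using x(1) unfolding interval_partition_def by force
    then show ?thesis using s x by blast
  qed
  from fuzzy_number_from_approx[OF this]
  obtain I where I: "\<And>\<alpha>. \<alpha> \<in> {0..1} \<Longrightarrow> lo I \<alpha> = ?A \<alpha> \<and> hi I \<alpha> = ?B \<alpha>" by blast
  have has: "has_fuzzy_integral f I a b"
    unfolding has_fuzzy_integral_def
  proof (intro allI impI)
    fix e :: real assume e: "e > 0"
    obtain \<delta> where d: "\<delta> > 0" and s: "\<forall>n x \<xi>. interval_partition n x a b \<and> (\<forall>i<n. x (Suc i) - x i < \<delta>) \<and>
          (\<forall>i<n. \<xi> i \<in> {x i..x (Suc i)}) \<longrightarrow>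
          (\<forall>\<alpha>\<in>{0..1}. \<bar>lo (\<Sum>i<n. (x (Suc i) - x i) *\<^sub>R f (\<xi> i)) \<alpha> - ?A \<alpha>\<bar> \<le> e/2 \<and>
            \<bar>hi (\<Sum>i<n. (x (Suc i) - x i) *\<^sub>R f (\<xi> i)) \<alpha> - ?B \<alpha>\<bar> \<le> e/2)"
      using riemann_sum_error_lo_hi[OF f, of "e/2"] e by auto
    have "dist (\<Sum>i<n. (x (Suc i) - x i) *\<^sub>R f (\<xi> i)) I < e"
      if "interval_partition n x a b \<and> (\<forall>i<n. x (Suc i) - x i < \<delta>) \<and> (\<forall>i<n. \<xi> i \<in> {x i..x (Suc i)})"
      for n x \<xi>
    proof -
      have "dist (\<Sum>i<n. (x (Suc i) - x i) *\<^sub>R f (\<xi> i)) I \<le> e/2"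
        unfolding dist_fuzzy_le_iff using s that I by simp
      then show ?thesis using e by simp
    qed
    then show "\<exists>\<delta>>0. \<forall>n x \<xi>. interval_partition n x a b \<and> (\<forall>i<n. x (Suc i) - x i < \<delta>) \<and>
        (\<forall>i<n. \<xi> i \<in> {x i..x (Suc i)}) \<longrightarrow> dist (\<Sum>i<n. (x (Suc i) - x i) *\<^sub>R f (\<xi> i)) I < e"
      using d by blast
  qed
  then have "fuzzy_integral a b f = I"
    unfolding fuzzy_integral_def using has_fuzzy_integral_unique[OF _ has ab] by blast
  then show "lo (fuzzy_integral a b f) \<alpha> = ?A \<alpha>" "hi (fuzzy_integral a b f) \<alpha> = ?B \<alpha>"
    using I[OF \<alpha>] by auto
qed

text \<open>On the compact interval \<open>f\<close> stays within some \<open>M\<close> of 0, so the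
  integral function is \<open>M\<close>-Lipschitz. This makes the outer integral of the Cesaro mean
  an integral of a continuous function.\<close>

lemma continuous_on_fuzzy_integral:
  fixes f :: "real \<Rightarrow> fuzzy_number"
  assumes f: "continuous_on {a..b} f"
  shows "continuous_on {a..b} (\<lambda>t. fuzzy_integral a t f)"
proof -
  have "compact (f ` {a..b})" using f by (intro compact_continuous_image) auto
  then obtain M where M: "\<And>x. x \<in> {a..b} \<Longrightarrow> dist 0 (f x) \<le> M"
    using compact_imp_bounded bounded_any_center[of "f ` {a..b}" 0] by blast
  have incr: "\<bar>integral {a..t} g - integral {a..s} g\<bar> \<le> M * (t - s)"
    if "continuous_on {a..b} g" "\<And>x. x \<in> {a..b} \<Longrightarrow> \<bar>g x\<bar> \<le> M" "a \<le> s" "s \<le> t" "t \<le> b"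
    for g :: "real \<Rightarrow> real" and s t
  proof -
    have "g integrable_on {a..t}"
      using that by (intro integrable_continuous_real) (auto intro: continuous_on_subset)
    then have "integral {a..t} g - integral {a..s} g = integral {s..t} g"
      using Henstock_Kurzweil_Integration.integral_combine[OF that(3,4), of g] by simp
    moreover have "norm (integral {s..t} g) \<le> M * (t - s)"
      using that by (intro integral_bound) (auto intro: continuous_on_subset)
    ultimately show ?thesis by simp
  qed
  have D: "dist (fuzzy_integral a t f) (fuzzy_integral a s f) \<le> M * (t - s)"
    if st: "a \<le> s" "s \<le> t" "t \<le> b" for s t
    unfolding dist_fuzzy_le_iff
  proof
    fix \<alpha> :: real assume a: "\<alpha> \<in> {0..1}"
    have bd: "\<bar>lo (f x) \<alpha>\<bar> \<le> M" "\<bar>hi (f x) \<alpha>\<bar> \<le> M" if "x \<in> {a..b}" for x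
      using abs_lo_hi_diff_le_dist[OF a, of 0 "f x"] M[OF that] lo_hi_zero[OF a] by auto
    have c: "continuous_on {a..t} f" "continuous_on {a..s} f"
      using f st by (auto intro: continuous_on_subset)
    show "\<bar>lo (fuzzy_integral a t f) \<alpha> - lo (fuzzy_integral a s f) \<alpha>\<bar> \<le> M * (t - s) \<and>
          \<bar>hi (fuzzy_integral a t f) \<alpha> - hi (fuzzy_integral a s f) \<alpha>\<bar> \<le> M * (t - s)"
      using lo_hi_fuzzy_integral[OF c(1) _ a] lo_hi_fuzzy_integral[OF c(2) _ a] st
        incr[OF continuous_on_lo_hi(1)[OF f a] bd(1) st] incr[OF continuous_on_lo_hi(2)[OF f a] bd(2) st]
      by simp
  qed
  show ?thesis
  proof (cases "a \<le> b")
    case True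
    \<comment> \<open>Only a point of the interval forces \<open>M\<close> to be nonnegative, hence
      the split on \<open>a \<le> b\<close>.\<close>
    then have "M \<ge> 0" using M[of a] zero_le_dist[of 0 "f a"] by (meson atLeastAtMost_iff order_refl order_trans)
    moreover have "dist (fuzzy_integral a t f) (fuzzy_integral a s f) \<le> M * dist t s"
      if "t \<in> {a..b}" "s \<in> {a..b}" for s t
      using D[of s t] D[of t s] that by (cases "s \<le> t") (auto simp: dist_real_def dist_commute)
    ultimately have "M-lipschitz_on {a..b} (\<lambda>t. fuzzy_integral a t f)"
      by (intro lipschitz_onI)
    then show ?thesis by (rule lipschitz_on_continuous_on)
  qed simp
qed

section \<open>The Tauberian estimate\<close>

text \<open>The bound contains neither \<open>g\<close> nor \<open>l\<close>, so it applies to both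
  endpoint functions at every level with the same constants. The means enter only at
  \<open>t / q\<close>, \<open>t\<close> and \<open>q * t\<close>, the ends of the two averaging
  windows.\<close>

lemma cesaro_tauberian_estimate:
  fixes g :: "real \<Rightarrow> real"
  assumes g: "continuous_on {0..} g"
    and lower: "\<And>x. x > x0 \<Longrightarrow> - c \<le> x * g x"
    and "x0 \<ge> 0" "c \<ge> 0" "q > 1" "t / q > x0"
    and mean: "\<And>r. r \<in> {t / q, t, q * t} \<Longrightarrow> \<bar>1 / r * integral {0..r} (\<lambda>v. integral {0..v} g) - l\<bar> \<le> \<eta>"
  shows "\<bar>integral {0..t} g - l\<bar> \<le> c * (q - 1) + \<eta> * (q + 1) / (q - 1)"
proof -
  define s where "s v = integral {0..v} g" for v
  define S where "S v = integral {0..v} s" for v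
  define p where "p = t / q"
  have p: "p > x0" "p > 0" and t: "t = q * p" using assms unfolding p_def by auto
  have pt: "p < t" "t < q * t" using p t \<open>q > 1\<close> by auto
  have contg: "continuous_on {a..b} g" if "a \<ge> 0" for a b
    by (rule continuous_on_subset[OF g]) (use that in auto)
  have conts: "continuous_on {a..b} s" if "a \<ge> 0" for a b
  proof -
    have "continuous_on {0..b} s" unfolding s_def
      by (intro indefinite_integral_continuous_1 integrable_continuous_real contg) simp
    then show ?thesis by (rule continuous_on_subset) (use that in auto)
  qed
  \<comment> \<open>Replacing \<open>- c / x\<close> by its least value \<open>- c / a\<close> on
    the interval gives a linear bound and avoids a logarithm.\<close>
  have s_incr: "s a - c * ((b - a) / a) \<le> s b" if ab: "p \<le> a" "a \<le> b" for a b
  proof -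
    have a: "a > 0" using ab p by auto
    have "- c / a \<le> g x" if "x \<in> {a..b}" for x
    proof -
      have "- c / a \<le> - c / x" using that a \<open>c \<ge> 0\<close> by (simp add: frac_le)
      also have "\<dots> \<le> g x" using lower[of x] that a ab p by (simp add: field_simps)
      finally show ?thesis .
    qed
    then have "integral {a..b} (\<lambda>_. - c / a) \<le> integral {a..b} g"
      using a by (intro integral_le integrable_continuous_real contg) auto
    moreover have "s a + integral {a..b} g = s b" unfolding s_def
      using a ab by (intro Henstock_Kurzweil_Integration.integral_combine integrable_continuous_real contg) auto
    ultimately show ?thesis using ab by (simp add: field_simps)
  qed
  have S_combine: "S b - S a = integral {a..b} s" if "0 \<le> a" "a \<le> b" for a b
    using Henstock_Kurzweil_Integration.integral_combine[OF that, of s] conts[of 0 b]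
    unfolding S_def by (simp add: integrable_continuous_real)
  \<comment> \<open>Multiplied out by \<open>r\<close>, the bounds on the means can be subtracted at
    two different radii.\<close>
  have S_close: "\<bar>S r - r * l\<bar> \<le> \<eta> * r" if "r \<in> {p, t, q * t}" for r
  proof -
    have r: "r > 0" using that p pt by auto
    have "\<bar>1 / r * S r - l\<bar> \<le> \<eta>" using mean[of r] that unfolding S_def s_def p_def by auto
    moreover have "\<bar>S r - r * l\<bar> = r * \<bar>1 / r * S r - l\<bar>"
      using r by (simp add: abs_if field_simps)
    ultimately show ?thesis using r by (simp add: mult.commute mult_left_mono)
  qed
  have upper: "s t - l \<le> c * (q - 1) + \<eta> * (q + 1) / (q - 1)"
  proof -
    have "s t - c * (q - 1) \<le> s v" if "v \<in> {t..q * t}" for v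
    proof -
      have "(v - t) / t \<le> q - 1" using that p pt by (simp add: field_simps)
      then have "c * ((v - t) / t) \<le> c * (q - 1)" using \<open>c \<ge> 0\<close> by (intro mult_left_mono)
      then show ?thesis using s_incr[of t v] that pt by auto
    qed
    then have "integral {t..q * t} (\<lambda>_. s t - c * (q - 1)) \<le> S (q * t) - S t"
      unfolding S_combine[of t "q * t", OF less_imp_le[OF less_trans[OF p(2) pt(1)]] less_imp_le[OF pt(2)]]
      using pt p by (intro integral_le integrable_continuous_real conts) auto
    then have "(q - 1) * t * (s t - c * (q - 1)) \<le> S (q * t) - S t"
      using pt by (simp add: algebra_simps)
    \<comment> \<open>\<open>S (q * t) - S t\<close> differs from \<open>(q - 1) * t * l\<close> by
      at most \<open>\<eta> * q * t + \<eta> * t\<close>; this is the source of the factor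
      \<open>q + 1\<close>.\<close>
    then have "t * ((q - 1) * (s t - l - c * (q - 1))) \<le> t * (\<eta> * (q + 1))"
      using S_close[of t] S_close[of "q * t"] by (simp add: algebra_simps abs_le_iff)
    then have "(q - 1) * (s t - l - c * (q - 1)) \<le> \<eta> * (q + 1)"
      using pt p by (simp add: mult_le_cancel_left)
    then have "s t - l - c * (q - 1) \<le> \<eta> * (q + 1) / (q - 1)"
      using \<open>q > 1\<close> by (simp add: pos_le_divide_eq mult.commute)
    then show ?thesis by simp
  qed
  \<comment> \<open>The hypothesis only limits how far \<open>s\<close> can fall, so bounding
    \<open>s t\<close> from below requires the window \<open>{p..t}\<close> preceding
    \<open>t\<close>.\<close>
  have "l - s t \<le> c * (q - 1) + \<eta> * (q + 1) / (q - 1)"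
  proof -
    have "s v \<le> s t + c * (q - 1)" if "v \<in> {p..t}" for v
    proof -
      have v: "v > 0" using that p by auto
      \<comment> \<open>The worst case is \<open>v = p\<close>, where equality holds.\<close>
      have "t \<le> q * v" using that t \<open>q > 1\<close> by auto
      then have "(t - v) / v \<le> q - 1" using v by (simp add: field_simps)
      then have "c * ((t - v) / v) \<le> c * (q - 1)" using \<open>c \<ge> 0\<close> by (intro mult_left_mono)
      then show ?thesis using s_incr[of v t] that by auto
    qed
    then have "S t - S p \<le> integral {p..t} (\<lambda>_. s t + c * (q - 1))"
      unfolding S_combine[of p t, OF less_imp_le[OF p(2)] less_imp_le[OF pt(1)]]
      using p by (intro integral_le integrable_continuous_real conts) auto
    then have "S t - S p \<le> (q - 1) * p * (s t + c * (q - 1))"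
      using pt unfolding t by (simp add: algebra_simps)
    then have "p * ((q - 1) * (l - s t - c * (q - 1))) \<le> p * (\<eta> * (q + 1))"
      using S_close[of t] S_close[of p] unfolding t by (simp add: algebra_simps abs_le_iff)
    then have "(q - 1) * (l - s t - c * (q - 1)) \<le> \<eta> * (q + 1)"
      using p by (simp add: mult_le_cancel_left)
    then have "l - s t - c * (q - 1) \<le> \<eta> * (q + 1) / (q - 1)"
      using \<open>q > 1\<close> by (simp add: pos_le_divide_eq mult.commute)
    then show ?thesis by simp
  qed
  then show ?thesis using upper unfolding s_def by linarith
qed

section \<open>Passage to the limit, uniformly in the level\<close>

theorem corollary3p13:
  fixes f :: "real \<Rightarrow> fuzzy_number" and L u :: fuzzy_number and x0 :: real
  assumes "continuous_on {0..} f"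
    and "cesaro_summable_to f L"
    and "negative_fuzzy u"
    and "x0 \<ge> 0"
    and "\<And>x. x > x0 \<Longrightarrow> u \<le> x *\<^sub>R f x"
  shows "fuzzy_integral_converges f L"
  unfolding fuzzy_integral_converges_def tendsto_iff
proof (intro allI impI)
  fix e :: real assume e: "e > 0"
  have f: "continuous_on {a..b} f" if "a \<ge> 0" for a b
    by (rule continuous_on_subset[OF assms(1)]) (use that in auto)
  \<comment> \<open>\<open>lo u 0\<close> is the least of all endpoints of \<open>u\<close>, so
    \<open>- c\<close> lies below both endpoints at every level.\<close>
  define c where "c = \<bar>lo u 0\<bar>"
  \<comment> \<open>Makes \<open>c * (q - 1) \<le> e / 4\<close>; the \<open>+ 1\<close> covers
    \<open>c = 0\<close>. Then \<open>\<eta>\<close> solves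
    \<open>\<eta> * (q + 1) / (q - 1) = e / 4\<close>.\<close>
  define q where "q = 1 + e / (4 * (c + 1))"
  define \<eta> where "\<eta> = e / 4 * (q - 1) / (q + 1)"
  have c: "c \<ge> 0" and q: "q > 1" unfolding c_def q_def using e by auto
  have \<eta>: "\<eta> > 0" unfolding \<eta>_def using e q by auto
  have "c * (q - 1) \<le> e / 4"
    unfolding q_def using c e by (simp add: field_simps)
  moreover have "\<eta> * (q + 1) = e / 4 * (q - 1)"
    unfolding \<eta>_def using q by (intro nonzero_eq_divide_eq[THEN iffD1] refl) simp
  then have "\<eta> * (q + 1) / (q - 1) = e / 4"
    using q by (simp add: nonzero_divide_eq_eq)
  ultimately have err: "c * (q - 1) + \<eta> * (q + 1) / (q - 1) \<le> e / 2" by linarith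
  have "\<forall>\<^sub>F r in at_top. dist (cesaro_mean f r) L < \<eta>"
    using assms(2) \<eta> unfolding cesaro_summable_to_def tendsto_iff by blast
  then obtain R where R: "\<And>r. r \<ge> R \<Longrightarrow> dist (cesaro_mean f r) L < \<eta>"
    unfolding eventually_at_top_linorder by blast
  have mean: "\<bar>1 / r * integral {0..r} (\<lambda>v. integral {0..v} (\<lambda>x. lo (f x) \<alpha>)) - lo L \<alpha>\<bar> \<le> \<eta>"
    "\<bar>1 / r * integral {0..r} (\<lambda>v. integral {0..v} (\<lambda>x. hi (f x) \<alpha>)) - hi L \<alpha>\<bar> \<le> \<eta>"
    if r: "r \<ge> R" "r > 0" and a: "\<alpha> \<in> {0..1}" for r \<alpha>
  proof -
    have "continuous_on {0..r} (\<lambda>v. fuzzy_integral 0 v f)"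
      by (intro continuous_on_fuzzy_integral f) simp
    note I = lo_hi_fuzzy_integral[OF this _ a]
    have "lo (cesaro_mean f r) \<alpha> = 1 / r * integral {0..r} (\<lambda>v. lo (fuzzy_integral 0 v f) \<alpha>)"
      "hi (cesaro_mean f r) \<alpha> = 1 / r * integral {0..r} (\<lambda>v. hi (fuzzy_integral 0 v f) \<alpha>)"
      unfolding cesaro_mean_def using r I by (simp_all add: lo_hi_scaleR[OF a])
    moreover have "integral {0..r} (\<lambda>v. lo (fuzzy_integral 0 v f) \<alpha>)
        = integral {0..r} (\<lambda>v. integral {0..v} (\<lambda>x. lo (f x) \<alpha>))"
      "integral {0..r} (\<lambda>v. hi (fuzzy_integral 0 v f) \<alpha>)
        = integral {0..r} (\<lambda>v. integral {0..v} (\<lambda>x. hi (f x) \<alpha>))"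
      by (intro Henstock_Kurzweil_Integration.integral_cong lo_hi_fuzzy_integral[OF f _ a]; simp)+
    ultimately show
      "\<bar>1 / r * integral {0..r} (\<lambda>v. integral {0..v} (\<lambda>x. lo (f x) \<alpha>)) - lo L \<alpha>\<bar> \<le> \<eta>"
      "\<bar>1 / r * integral {0..r} (\<lambda>v. integral {0..v} (\<lambda>x. hi (f x) \<alpha>)) - hi L \<alpha>\<bar> \<le> \<eta>"
      using abs_lo_hi_diff_le_dist[OF a, of "cesaro_mean f r" L] R[OF r(1)] by auto
  qed
  have lower: "- c \<le> x * lo (f x) \<alpha>" "- c \<le> x * hi (f x) \<alpha>"
    if x: "x > x0" and a: "\<alpha> \<in> {0..1}" for x \<alpha>
  proof -
    have "lo u \<alpha> \<le> x * lo (f x) \<alpha>" "hi u \<alpha> \<le> x * hi (f x) \<alpha>"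
      using assms(5)[OF x] a x assms(4) unfolding less_eq_fuzzy_number_def
      by (auto simp: lo_hi_scaleR)
    then show "- c \<le> x * lo (f x) \<alpha>" "- c \<le> x * hi (f x) \<alpha>"
      using lo_hi_bounds[OF a, of u] unfolding c_def by linarith+
  qed
  \<comment> \<open>The threshold pushes \<open>t / q\<close>, the smallest of the three radii,
    beyond both \<open>R\<close> and \<open>x0\<close>.\<close>
  have "dist (fuzzy_integral 0 t f) L < e" if t: "t > q * max R x0" "t > 0" for t
  proof -
    have "t / q > max R x0" using t q by (simp add: pos_less_divide_eq mult.commute del: max_less_iff_conj)
    then have tq: "t / q > R" "t / q > x0" by auto
    have le: "t / q \<le> t" "t \<le> q * t" using t q by (auto simp: field_simps)
    have r: "r \<ge> R" "r > 0" if "r \<in> {t / q, t, q * t}" for r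
    proof -
      have "t / q \<le> r" using that le by fastforce
      then show "r \<ge> R" "r > 0" using tq assms(4) by linarith+
    qed
    \<comment> \<open>The levelwise estimates give a non-strict bound on the supremum; aiming at
      \<open>e / 2\<close> restores strictness.\<close>
    have "dist (fuzzy_integral 0 t f) L \<le> e / 2"
      unfolding dist_fuzzy_le_iff
    proof
      fix \<alpha> :: real assume a: "\<alpha> \<in> {0..1}"
      note est = cesaro_tauberian_estimate[OF _ _ assms(4) c q tq(2)]
      have "\<bar>integral {0..t} (\<lambda>x. lo (f x) \<alpha>) - lo L \<alpha>\<bar> \<le> c * (q - 1) + \<eta> * (q + 1) / (q - 1)"
        by (rule est[OF continuous_on_lo_hi(1)[OF assms(1) a] lower(1)[OF _ a] mean(1)[OF r a]])
      moreover have "\<bar>integral {0..t} (\<lambda>x. hi (f x) \<alpha>) - hi L \<alpha>\<bar> \<le> c * (q - 1) + \<eta> * (q + 1) / (q - 1)"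
        by (rule est[OF continuous_on_lo_hi(2)[OF assms(1) a] lower(2)[OF _ a] mean(2)[OF r a]])
      ultimately show "\<bar>lo (fuzzy_integral 0 t f) \<alpha> - lo L \<alpha>\<bar> \<le> e / 2 \<and>
          \<bar>hi (fuzzy_integral 0 t f) \<alpha> - hi L \<alpha>\<bar> \<le> e / 2"
        unfolding lo_hi_fuzzy_integral[OF f[OF order_refl] less_imp_le[OF t(2)] a]
        using err by linarith
    qed
    then show ?thesis using e by simp
  qed
  moreover have "\<forall>\<^sub>F t in at_top. t > q * max R x0 \<and> t > 0"
    by (intro eventually_conj eventually_gt_at_top)
  ultimately show "\<forall>\<^sub>F t in at_top. dist (fuzzy_integral 0 t f) L < e"
    by (auto elim: eventually_mono)
qed

end
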